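(* Let the integer sequence $(a(n))_{n \geq 0}$ be defined recursively by $a(0) = 1$ and $a(n) = \sum_{k=0}^{n-1} \binom{n-1}{k}^{2} a(k)$ for $n \geq 1$. Then, for all positive integers $n$, the number of immacutations of order $n$ is equal to $a(n)$.
   Context: For a finite tuple $t$, $\ell(t)$ denotes its length and $t = (t_1, t_2, \ldots, t_{\ell(t)})$. A weak partition is a finite tuple of weakly decreasing nonnegative integers. Let $n$ be a positive integer, and let $\lambda$ be a strictly decreasing weak partition that ends with $0$ (so its last entry is $0$ and it is nonempty) and whose largest part is at most $n-1$. An immacutation of order $n$ (and of class $\lambda$) is a tuple $t$ of length $2\ell(\lambda)$ such that $t_1$ and $t_2$ are subsets of $\{1, 2, \ldots, n-1\}$ of size $n-1-\lambda_1$, and such that, for each $i \in \{2, 3, \ldots, \ell(\lambda)\}$, $t_{2i-1}$ and $t_{2i}$ are subsets of $\{1, 2, \ldots, \lambda_{i-1}-1\}$ of size $\lambda_{i-1} - 1 - \lambda_i$. The immacutations of order $n$ are all the tuples so obtained, over all such $\lambda$. *)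

theory Defs
  imports Complex_Main
begin

(* Tuples are lists; entry t i is the 1-based entry t_i, for 1 <= i <= length t. *)
definition entry :: "'a list \<Rightarrow> nat \<Rightarrow> 'a" where
  "entry t i = t ! (i - 1)"

definition weak_partition :: "nat list \<Rightarrow> bool" where
  "weak_partition l \<longleftrightarrow> sorted_wrt (\<ge>) l"

definition immacutation_class :: "nat \<Rightarrow> nat list \<Rightarrow> bool" where
  "immacutation_class n l \<longleftrightarrow>
     weak_partition l \<and> sorted_wrt (>) l \<and> l \<noteq> [] \<and> last l = 0 \<and> entry l 1 \<le> n - 1"

(* For n > 0 and immacutation_class n l, none of the subtractions below truncates. *)
definition immacutation_of_class :: "nat \<Rightarrow> nat list \<Rightarrow> nat set list \<Rightarrow> bool" where
  "immacutation_of_class n l t \<longleftrightarrow>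
     length t = 2 * length l \<and>
     entry t 1 \<subseteq> {1..n - 1} \<and> card (entry t 1) = n - 1 - entry l 1 \<and>
     entry t 2 \<subseteq> {1..n - 1} \<and> card (entry t 2) = n - 1 - entry l 1 \<and>
     (\<forall>i\<in>{2..length l}.
        entry t (2 * i - 1) \<subseteq> {1..entry l (i - 1) - 1} \<and>
        card (entry t (2 * i - 1)) = entry l (i - 1) - 1 - entry l i \<and>
        entry t (2 * i) \<subseteq> {1..entry l (i - 1) - 1} \<and>
        card (entry t (2 * i)) = entry l (i - 1) - 1 - entry l i)"

definition immacutations :: "nat \<Rightarrow> nat set list set" where
  "immacutations n = {t. \<exists>l. immacutation_class n l \<and> immacutation_of_class n l t}"

function a_seq :: "nat \<Rightarrow> nat" where
  "a_seq n = (if n = 0 then 1 else (\<Sum>k = 0..n - 1. ((n - 1) choose k)\<^sup>2 * a_seq k))"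
  by auto
termination
  by (relation "measure id") auto

declare a_seq.simps [simp del]

end

theory Submission
  imports Defs
begin

text \<open>
  Both sides satisfy the same recursion. The class \<open>k # l\<close> of an immacutation of order
  \<open>n\<close> starts with some \<open>k \<le> n - 1\<close>, and the conditions on the remaining entries \<open>l\<close> and on
  the sets from the third one onwards are the conditions for an immacutation of order \<open>k\<close>, since
  strict decrease bounds the next part by \<open>k - 1\<close>, and the third and fourth sets live in
  \<open>{1..k - 1}\<close>. Removing the first two sets therefore leaves an
  immacutation of order \<open>k\<close>, or the empty tuple if \<open>k = 0\<close>. The removed sets range
  independently over the subsets of \<open>{1..n - 1}\<close> of size \<open>n - 1 - k\<close>, which gives the factor
  \<open>(n - 1 choose k)\<^sup>2\<close>; their size determines \<open>k\<close>, so no tuple is counted for two values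
  of \<open>k\<close>. This is \<open>immacutations_recursion\<close>, and the theorem follows by strong
  induction.
\<close>

text \<open>
  What can follow the first two sets when the class starts with \<open>k\<close>. A class stops as soon as
  it reaches \<open>0\<close>, so at order \<open>0\<close> only the empty tuple can follow. In contrast,
  \<open>immacutations 0\<close> is \<open>{[{}, {}]}\<close>, because \<open>0 - 1 = 0\<close> on the natural numbers.
\<close>

definition immacutation_tails :: "nat \<Rightarrow> nat set list set" where
  "immacutation_tails k = (if k = 0 then {[]} else immacutations k)"

lemma entry_simps:
  "entry (x # xs) (Suc 0) = x"
  "entry (x # xs) 1 = x"
  "entry (x # y # xs) 2 = y"
  "i \<ge> 2 \<Longrightarrow> entry (x # xs) i = entry xs (i - 1)"
  "i \<ge> 3 \<Longrightarrow> entry (x # y # xs) i = entry xs (i - 2)"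
proof -
  show "i \<ge> 2 \<Longrightarrow> entry (x # xs) i = entry xs (i - 1)"
    by (simp add: entry_def nth_Cons')
  show "i \<ge> 3 \<Longrightarrow> entry (x # y # xs) i = entry xs (i - 2)"
    by (simp add: entry_def nth_Cons' numeral_eq_Suc)
qed (simp_all add: entry_def)

lemma ball_from_2_Suc:
  "(\<forall>i\<in>{2..Suc m}. P i) \<longleftrightarrow> m = 0 \<or> (P 2 \<and> (\<forall>j\<in>{2..m}. P (Suc j)))"
proof (cases "m = 0")
  case False
  then have "{2..Suc m} = insert 2 (Suc ` {2..m})"
    by auto
  then show ?thesis
    using False by (simp only: ball_simps) simp
qed simp

lemma immacutation_class_Cons:
  assumes "n > 0"
  shows "immacutation_class n (k # l) \<longleftrightarrow>
    k \<le> n - 1 \<and> (if k = 0 then l = [] else immacutation_class k l)"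
proof (cases l)
  case Nil
  then show ?thesis
    by (auto simp: immacutation_class_def weak_partition_def entry_simps)
next
  case (Cons m l')
  then show ?thesis
    by (auto simp: immacutation_class_def weak_partition_def entry_simps)
qed

lemma immacutation_of_class_Cons:
  "immacutation_of_class n (k # l) (A # B # t) \<longleftrightarrow>
    A \<subseteq> {1..n - 1} \<and> card A = n - 1 - k \<and> B \<subseteq> {1..n - 1} \<and> card B = n - 1 - k \<and>
    (if l = [] then t = [] else immacutation_of_class k l t)"
proof (cases l)
  case Nil
  then show ?thesis
    by (auto simp: immacutation_of_class_def entry_simps)
next
  case (Cons m l')
  have shift: "entry (k # l) (Suc j - 1) = entry l (j - 1)"
    "entry (k # l) (Suc j) = entry l j"
    "entry (A # B # t) (2 * Suc j - 1) = entry t (2 * j - 1)"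
    "entry (A # B # t) (2 * Suc j) = entry t (2 * j)" if "j \<in> {2..length l}" for j
    using that by (simp_all add: entry_simps)
  have first: "entry (k # l) (2 - 1) = k" "entry (k # l) 2 = entry l 1"
    "entry (A # B # t) (2 * 2 - 1) = entry t 1" "entry (A # B # t) (2 * 2) = entry t 2"
    by (simp_all add: entry_simps)
  have len: "length (k # l) = Suc (length l)" "length l \<noteq> 0" "l \<noteq> []"
    using Cons by auto
  show ?thesis
    unfolding immacutation_of_class_def len(1) ball_from_2_Suc first
    using len by (auto simp: shift entry_simps simp del: One_nat_def)
qed

lemma immacutations_recursion:
  assumes "n > 0"
  shows "immacutations n = (\<Union>k\<in>{0..n - 1}.
    (\<lambda>(A, B, t). A # B # t) `
      ({A. A \<subseteq> {1..n - 1} \<and> card A = n - 1 - k} \<times>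
       {B. B \<subseteq> {1..n - 1} \<and> card B = n - 1 - k} \<times> immacutation_tails k))"
    (is "_ = (\<Union>k\<in>_. ?f ` ?X k)")
proof (intro set_eqI iffI)
  fix u
  assume "u \<in> immacutations n"
  then obtain l where l: "immacutation_class n l" "immacutation_of_class n l u"
    by (auto simp: immacutations_def)
  then have "l \<noteq> []"
    by (simp add: immacutation_class_def)
  then obtain k l' where [simp]: "l = k # l'"
    by (cases l) auto
  have "length u = Suc (Suc (2 * length l'))"
    using l(2) by (simp add: immacutation_of_class_def)
  then obtain A B t where [simp]: "u = A # B # t"
    by (auto simp: length_Suc_conv)
  note c = l(1)[simplified, unfolded immacutation_class_Cons[OF assms]]
  note o = l(2)[simplified, unfolded immacutation_of_class_Cons]
  have "t \<in> immacutation_tails k"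
  proof (cases "k = 0")
    case True
    then show ?thesis
      using c o by (simp add: immacutation_tails_def)
  next
    case False
    then have "l' \<noteq> []"
      using c by (auto simp: immacutation_class_def)
    then show ?thesis
      using False c o by (auto simp: immacutation_tails_def immacutations_def)
  qed
  then have "u \<in> ?f ` ?X k"
    using o by (intro image_eqI[of _ _ "(A, B, t)"]) auto
  then show "u \<in> (\<Union>k\<in>{0..n - 1}. ?f ` ?X k)"
    using c by (intro UN_I[of k]) simp_all
next
  fix u
  assume "u \<in> (\<Union>k\<in>{0..n - 1}. ?f ` ?X k)"
  then obtain k A B t where k: "k \<le> n - 1" and u: "u = A # B # t"
    and AB: "A \<subseteq> {1..n - 1}" "card A = n - 1 - k" "B \<subseteq> {1..n - 1}" "card B = n - 1 - k"
    and t: "t \<in> immacutation_tails k"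
    by auto
  obtain l where "if k = 0 then l = [] else immacutation_class k l"
    and "if l = [] then t = [] else immacutation_of_class k l t"
  proof (cases "k = 0")
    case True
    then show ?thesis
      using t that[of "[]"] by (simp add: immacutation_tails_def)
  next
    case False
    then obtain l where "immacutation_class k l" "immacutation_of_class k l t"
      using t by (auto simp: immacutation_tails_def immacutations_def)
    then show ?thesis
      using False that[of l] by (auto simp: immacutation_class_def)
  qed
  then have "immacutation_class n (k # l)" "immacutation_of_class n (k # l) u"
    unfolding immacutation_class_Cons[OF assms] u immacutation_of_class_Cons
    using k AB by auto
  then show "u \<in> immacutations n"
    by (auto simp: immacutations_def)
qed

lemma card_immacutation_tails:
  "finite (immacutation_tails n) \<and> card (immacutation_tails n) = a_seq n"
proof (induction n rule: less_induct)
  case (less n)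
  show ?case
  proof (cases "n = 0")
    case True
    then show ?thesis
      by (simp add: immacutation_tails_def a_seq.simps)
  next
    case False
    define P where "P k = {A. A \<subseteq> {1..n - 1} \<and> card A = n - 1 - k}" for k
    define f :: "nat set \<times> nat set \<times> nat set list \<Rightarrow> nat set list"
      where "f = (\<lambda>(A, B, t). A # B # t)"
    define X where "X k = f ` (P k \<times> P k \<times> immacutation_tails k)" for k
    have union: "immacutation_tails n = (\<Union>k\<in>{0..n - 1}. X k)"
      using False immacutations_recursion[of n]
      by (simp add: immacutation_tails_def P_def X_def f_def)
    have fin_P: "finite (P k)" for k
      by (simp add: P_def)
    have card_P: "card (P k) = (n - 1) choose k" if "k \<le> n - 1" for k
      using n_subsets[of "{1..n - 1}" "n - 1 - k"] binomial_symmetric[OF that]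
      by (simp add: P_def)
    have inj: "inj_on f S" for S
      by (auto simp: f_def inj_on_def)
    have fin_X: "finite (X k)"
      and card_X: "card (X k) = ((n - 1) choose k)\<^sup>2 * a_seq k" if "k \<le> n - 1" for k
    proof -
      have "finite (immacutation_tails k)" "card (immacutation_tails k) = a_seq k"
        using less[of k] that False by auto
      then show "finite (X k)" "card (X k) = ((n - 1) choose k)\<^sup>2 * a_seq k"
        using that by (simp_all add: X_def fin_P card_image[OF inj] card_cartesian_product card_P
            power2_eq_square)
    qed
    \<comment> \<open>The size \<open>n - 1 - k\<close> of the first set determines \<open>k\<close> because \<open>k \<le> n - 1\<close>.\<close>
    have disj: "X j \<inter> X k = {}" if "j \<le> n - 1" "k \<le> n - 1" "j \<noteq> k" for j k
      using that by (auto simp: X_def f_def P_def)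
    have "card (immacutation_tails n) = (\<Sum>k = 0..n - 1. card (X k))"
      unfolding union by (intro card_UN_disjoint) (auto simp: fin_X disj)
    also have "\<dots> = (\<Sum>k = 0..n - 1. ((n - 1) choose k)\<^sup>2 * a_seq k)"
      by (intro sum.cong) (auto simp: card_X)
    also have "\<dots> = a_seq n"
      using False by (subst (2) a_seq.simps) simp
    finally show ?thesis
      unfolding union using fin_X by auto
  qed
qed

theorem theorem2:
  fixes n :: nat
  assumes "n > 0"
  shows "card (immacutations n) = a_seq n"
  using card_immacutation_tails[of n] assms by (simp add: immacutation_tails_def)

end
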